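(* Let $M$ be a matroid on the ground set $[n]=\{x_1,\ldots,x_n\}$, let $\alpha\in\mathbb{N}^n$, and let $i\in\{1,2,3\}$. Then $$M\in\mathrm{TE}(i)\iff M^\alpha\in\mathrm{TE}(i).$$
   Context: A matroid $M$ is a finite ground set $\mathcal{E}_M$ with a non-empty family $\mathcal{B}_M$ of bases satisfying the exchange property. Here $\mathbb{N}$ denotes the positive integers. Write $[n]=\{x_1,\ldots,x_n\}$ and, for $\alpha=(k_1,\ldots,k_n)\in\mathbb{N}^n$, $[n]^\alpha=\{x_{ij}:1\le i\le n,\ 1\le j\le k_i\}$. For $A=\{x_{i_1},\ldots,x_{i_r}\}\subseteq[n]$ (with $r$ distinct elements) put $\{A\}^\alpha=\{\{x_{i_1j_1},\ldots,x_{i_rj_r}\}:1\le j_l\le k_{i_l}\text{ for all }l\}$, and for a family $\mathcal{A}$ of subsets of $[n]$ put $\mathcal{A}^\alpha=\bigcup_{A\in\mathcal{A}}\{A\}^\alpha$. The expansion $M^\alpha$ of a matroid $M$ on $[n]$ is the matroid with ground set $[n]^\alpha$ and basis set $(\mathcal{B}_M)^\alpha$ (it is known that this is a matroid). Let $M$ be a matroid. Two sequences of bases $(A_1,\ldots,A_m)$ and $(B_1,\ldots,B_m)$ are compatible if $A_1\cup\cdots\cup A_m=B_1\cup\cdots\cup B_m$ as multisets (each element of the ground set lies in the same number of the $A_k$ as of the $B_k$). Let $1\le r<s\le m$. If $x\in A_r$ and $y\in A_s$ are such that $(A_r\setminus x)\cup y$ and $(A_s\setminus y)\cup x$ are both bases,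 then the sequence obtained from $(A_1,\ldots,A_m)$ by replacing $A_r$ by $(A_r\setminus x)\cup y$ and $A_s$ by $(A_s\setminus y)\cup x$ is said to be obtained by a symmetric exchange. If $U\subseteq A_r$ and $V\subseteq A_s$ are such that $(A_r\setminus U)\cup V$ and $(A_s\setminus V)\cup U$ are both bases, then the sequence obtained by replacing $A_r$ by $(A_r\setminus U)\cup V$ and $A_s$ by $(A_s\setminus V)\cup U$ is said to be obtained by a symmetric subset exchange. Write $\sim^1_M$ for the relation "is obtained by a symmetric exchange", $\sim^2_M$ for "is obtained by a symmetric exchange or by a permutation of the order of the bases", and $\sim^3_M$ for "is obtained by a symmetric subset exchange". For $i=1,2,3$, $\mathrm{TE}(i)$ is the class of matroids $M$ such that, for every $m\ge 1$, any two compatible sequences $(A_1,\ldots,A_m)$, $(B_1,\ldots,B_m)$ of bases of $M$ are connected by a finite (possibly empty) chain of $\sim^i_M$ steps through sequences of $m$ bases of $M$, leading from $(A_1,\ldots,A_m)$ to $(B_1,\ldots,B_m)$. *)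

theory Defs
  imports Main "HOL-Combinatorics.Permutations"
begin

record 'a pre_matroid =
  ground :: "'a set"
  bases :: "'a set set"

definition matroid :: "'a pre_matroid \<Rightarrow> bool" where
  "matroid M \<longleftrightarrow>
     finite (ground M) \<and> bases M \<noteq> {} \<and> (\<forall>A\<in>bases M. A \<subseteq> ground M) \<and>
     (\<forall>A\<in>bases M. \<forall>B\<in>bases M. \<forall>x\<in>A - B. \<exists>y\<in>B - A. insert y (A - {x}) \<in> bases M)"

(* The exponent vector is a function k on the ground set, k (x_i) being the i-th entry;
   the copy x_ij of x_i is the pair (x_i, j) with 1 <= j <= k (x_i). *)

definition expand_ground :: "('a \<Rightarrow> nat) \<Rightarrow> 'a set \<Rightarrow> ('a \<times> nat) set" where
  "expand_ground k E = (SIGMA a:E. {1..k a})"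

(* c selects one copy of each element of A. *)

definition expand_set :: "('a \<Rightarrow> nat) \<Rightarrow> 'a set \<Rightarrow> ('a \<times> nat) set set" where
  "expand_set k A = {(\<lambda>a. (a, c a)) ` A | c. \<forall>a\<in>A. c a \<in> {1..k a}}"

definition expand_family :: "('a \<Rightarrow> nat) \<Rightarrow> 'a set set \<Rightarrow> ('a \<times> nat) set set" where
  "expand_family k F = (\<Union>A\<in>F. expand_set k A)"

definition expansion :: "('a \<Rightarrow> nat) \<Rightarrow> 'a pre_matroid \<Rightarrow> ('a \<times> nat) pre_matroid" where
  "expansion k M = \<lparr>ground = expand_ground k (ground M), bases = expand_family k (bases M)\<rparr>"

(* Sequences of m bases are lists of length m, so positions run over 0, ..., m - 1. *)

definition basis_seqs :: "'a pre_matroid \<Rightarrow> nat \<Rightarrow> 'a set list set" where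
  "basis_seqs M m = {As. length As = m \<and> set As \<subseteq> bases M}"

definition compatible :: "'a pre_matroid \<Rightarrow> 'a set list \<Rightarrow> 'a set list \<Rightarrow> bool" where
  "compatible M As Bs \<longleftrightarrow> length As = length Bs \<and>
     (\<forall>e\<in>ground M. card {k. k < length As \<and> e \<in> As ! k} = card {k. k < length Bs \<and> e \<in> Bs ! k})"

definition symmetric_exchange :: "'a pre_matroid \<Rightarrow> 'a set list \<Rightarrow> 'a set list \<Rightarrow> bool" where
  "symmetric_exchange M As Bs \<longleftrightarrow>
     (\<exists>r s x y. r < s \<and> s < length As \<and> x \<in> As ! r \<and> y \<in> As ! s \<and>
        (As ! r - {x}) \<union> {y} \<in> bases M \<and> (As ! s - {y}) \<union> {x} \<in> bases M \<and>
        Bs = As[r := (As ! r - {x}) \<union> {y}, s := (As ! s - {y}) \<union> {x}])"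

definition symmetric_subset_exchange :: "'a pre_matroid \<Rightarrow> 'a set list \<Rightarrow> 'a set list \<Rightarrow> bool" where
  "symmetric_subset_exchange M As Bs \<longleftrightarrow>
     (\<exists>r s U V. r < s \<and> s < length As \<and> U \<subseteq> As ! r \<and> V \<subseteq> As ! s \<and>
        (As ! r - U) \<union> V \<in> bases M \<and> (As ! s - V) \<union> U \<in> bases M \<and>
        Bs = As[r := (As ! r - U) \<union> V, s := (As ! s - V) \<union> U])"

definition reordering :: "'a set list \<Rightarrow> 'a set list \<Rightarrow> bool" where
  "reordering As Bs \<longleftrightarrow> (\<exists>p. p permutes {..<length As} \<and> Bs = permute_list p As)"

definition te_step :: "nat \<Rightarrow> 'a pre_matroid \<Rightarrow> 'a set list \<Rightarrow> 'a set list \<Rightarrow> bool" where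
  "te_step i M As Bs \<longleftrightarrow>
     i = 1 \<and> symmetric_exchange M As Bs \<or>
     i = 2 \<and> (symmetric_exchange M As Bs \<or> reordering As Bs) \<or>
     i = 3 \<and> symmetric_subset_exchange M As Bs"

definition TE :: "nat \<Rightarrow> 'a pre_matroid set" where
  "TE i = {M. matroid M \<and>
     (\<forall>m\<ge>1. \<forall>As\<in>basis_seqs M m. \<forall>Bs\<in>basis_seqs M m. compatible M As Bs \<longrightarrow>
        (\<lambda>X Y. X \<in> basis_seqs M m \<and> Y \<in> basis_seqs M m \<and> te_step i M X Y)\<^sup>*\<^sup>* As Bs)}"

end

theory Submission
  imports Defs
begin

text \<open>Forgetting the copy index projects a sequence of bases of the expansion to a sequence of bases
of the matroid, and every step of any of the three kinds projects to a step of the same kind or to the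
identity; this gives one direction. Conversely, a step of the matroid lifts to the expansion from any
given lift of its source: since all bases have the same size, the sets brought in by an exchange are
disjoint from what they join, so a lift contains no two copies of an element. Hence two compatible
sequences of the expansion reduce to the case where their projections agree, and then they differ
only in the distribution of the copies of each element, which is corrected by exchanging
pairs of parallel elements.\<close>

section \<open>Multiplicities of elements in sequences of bases\<close>

text \<open>A sum over the list rather than a cardinality of a set of positions, so that list
  induction, single updates and invariance under reordering are directly available.\<close>

definition occ :: "'a set list \<Rightarrow> 'a \<Rightarrow> nat" where
  "occ As e = (\<Sum>A\<leftarrow>As. of_bool (e \<in> A))"

lemma occ_eq_card: "occ As e = card {k. k < length As \<and> e \<in> As ! k}"
proof -
  have "occ As e = length (filter (\<lambda>A. e \<in> A) As)"
    unfolding occ_def by (induction As) auto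
  then show ?thesis by (simp add: length_filter_conv_card)
qed

lemma compatible_iff_occ:
  "compatible M As Bs \<longleftrightarrow> length As = length Bs \<and> (\<forall>e\<in>ground M. occ As e = occ Bs e)"
  by (simp add: compatible_def occ_eq_card)

lemma compatible_sym: "compatible M As Bs \<Longrightarrow> compatible M Bs As"
  by (auto simp: compatible_def)

lemma compatible_trans: "compatible M As Bs \<Longrightarrow> compatible M Bs Cs \<Longrightarrow> compatible M As Cs"
  unfolding compatible_iff_occ by simp

text \<open>Both contributions are added rather than subtracted, since subtraction on
  \<open>nat\<close> would truncate.\<close>

lemma occ_list_update:
  "r < length As \<Longrightarrow> occ (As[r := X]) e + of_bool (e \<in> As ! r) = occ As e + of_bool (e \<in> X)"
proof (induction As arbitrary: r)
  case (Cons A As)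
  then show ?case by (cases r) (auto simp: occ_def)
qed simp

section \<open>Cardinalities of bases and disjointness in exchanges\<close>

lemma basis_finite: "matroid M \<Longrightarrow> A \<in> bases M \<Longrightarrow> finite A"
  unfolding matroid_def by (meson finite_subset)

lemma basis_subset_ground: "matroid M \<Longrightarrow> A \<in> bases M \<Longrightarrow> A \<subseteq> ground M"
  unfolding matroid_def by blast

lemma basis_exchange:
  assumes "matroid M" "A \<in> bases M" "B \<in> bases M" "x \<in> A - B"
  obtains y where "y \<in> B - A" "insert y (A - {x}) \<in> bases M"
  using assms unfolding matroid_def by meson

text \<open>Exchanging an element of \<open>A - B\<close> for one of \<open>B - A\<close> keeps the
  size of \<open>A\<close> and shrinks \<open>A - B\<close>, so induction on the size of
  \<open>A - B\<close> ends at \<open>A = B\<close>.\<close>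

lemma card_bases_eq:
  assumes "matroid M" "A \<in> bases M" "B \<in> bases M"
  shows "card A = card B"
  using assms(2)
proof (induction "card (A - B)" arbitrary: A rule: less_induct)
  case less
  note fin = basis_finite[OF assms(1)]
  show ?case
  proof (cases "A \<subseteq> B")
    case True
    \<comment> \<open>An element of \<open>B - A\<close> would have to be exchanged for one of
      \<open>A - B\<close>, which is empty here.\<close>
    then have "B \<subseteq> A"
      using basis_exchange[OF assms(1,3) less.prems] by blast
    then show ?thesis using True by simp
  next
    case False
    then obtain x where x: "x \<in> A - B" by blast
    then obtain y where y: "y \<in> B - A" "insert y (A - {x}) \<in> bases M"
      using basis_exchange[OF assms(1) less.prems assms(3)] by blast
    have "insert y (A - {x}) - B = A - B - {x}"
      using y(1) by blast
    then have "card (insert y (A - {x}) - B) < card (A - B)"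
      using x fin[OF less.prems] by (simp only: card_Diff1_less finite_Diff)
    then have "card (insert y (A - {x})) = card B"
      by (rule less.hyps[OF _ y(2)])
    moreover have "card (insert y (A - {x})) = card A"
      using x y(1) fin[OF less.prems] card.remove[of A x] by simp
    ultimately show ?thesis by simp
  qed
qed

text \<open>Equicardinality gives
  \<open>card (A - U) + card V = card A + card ((A - U) \<inter> V)\<close> and its mirror image.
  Adding the two, the left sides total \<open>card A + card B\<close>, so both intersections are
  empty. Either equation alone would only compare the sizes of \<open>U\<close> and
  \<open>V\<close>.\<close>

lemma subset_exchange_disjoint:
  assumes "matroid M" "A \<in> bases M" "B \<in> bases M" "U \<subseteq> A" "V \<subseteq> B"
    and "(A - U) \<union> V \<in> bases M" "(B - V) \<union> U \<in> bases M"
  shows "(A - U) \<inter> V = {}" "(B - V) \<inter> U = {}"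
proof -
  have finA: "finite A" and finB: "finite B"
    using assms basis_finite by blast+
  have finU: "finite U" and finV: "finite V"
    using assms(4,5) finA finB finite_subset by blast+
  have cA: "card ((A - U) \<union> V) = card A" and cB: "card ((B - V) \<union> U) = card B"
    using card_bases_eq[OF assms(1)] assms by blast+
  have "card (A - U) + card V = card A + card ((A - U) \<inter> V)"
    using card_Un_Int[of "A - U" V] finA finV cA by simp
  moreover have "card (B - V) + card U = card B + card ((B - V) \<inter> U)"
    using card_Un_Int[of "B - V" U] finB finU cB by simp
  moreover have "card (A - U) + card U = card A"
    using finU finA assms(4) by (metis card_Diff_subset card_mono le_add_diff_inverse2)
  moreover have "card (B - V) + card V = card B"
    using finV finB assms(5) by (metis card_Diff_subset card_mono le_add_diff_inverse2)
  ultimately have "card ((A - U) \<inter> V) = 0" "card ((B - V) \<inter> U) = 0"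
    by linarith+
  then show "(A - U) \<inter> V = {}" "(B - V) \<inter> U = {}"
    using finA finB by auto
qed

section \<open>Steps and their effect on compatibility\<close>

lemma symmetric_exchange_imp_subset_exchange:
  assumes "symmetric_exchange M As Bs"
  shows "symmetric_subset_exchange M As Bs"
proof -
  obtain r s x y where "r < s" "s < length As" "x \<in> As ! r" "y \<in> As ! s"
    "(As ! r - {x}) \<union> {y} \<in> bases M" "(As ! s - {y}) \<union> {x} \<in> bases M"
    "Bs = As[r := (As ! r - {x}) \<union> {y}, s := (As ! s - {y}) \<union> {x}]"
    using assms unfolding symmetric_exchange_def by blast
  then show ?thesis
    unfolding symmetric_subset_exchange_def
    by (intro exI[of _ r] exI[of _ s] exI[of _ "{x}"] exI[of _ "{y}"]) simp
qed

lemma symmetric_exchange_imp_te_step: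
  "i \<in> {1, 2, 3} \<Longrightarrow> symmetric_exchange M As Bs \<Longrightarrow> te_step i M As Bs"
  using symmetric_exchange_imp_subset_exchange by (auto simp: te_step_def)

text \<open>The condition is symmetric in the two positions: if \<open>s < r\<close>, the pairs
  \<open>(r, x)\<close> and \<open>(s, y)\<close> trade roles and the two updates commute.\<close>

lemma symmetric_exchangeI:
  assumes "r \<noteq> s" "r < length As" "s < length As" "x \<in> As ! r" "y \<in> As ! s"
    and "insert y (As ! r - {x}) \<in> bases M" "insert x (As ! s - {y}) \<in> bases M"
    and "Bs = As[r := insert y (As ! r - {x}), s := insert x (As ! s - {y})]"
  shows "symmetric_exchange M As Bs"
proof (cases "r < s")
  case True
  then show ?thesis
    unfolding symmetric_exchange_def using assms
    by (intro exI[of _ r] exI[of _ s] exI[of _ x] exI[of _ y]) simp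
next
  case False
  then show ?thesis
    unfolding symmetric_exchange_def using assms
    by (intro exI[of _ s] exI[of _ r] exI[of _ y] exI[of _ x])
      (simp add: list_update_swap)
qed

lemma basis_seqsD: "As \<in> basis_seqs M m \<Longrightarrow> r < m \<Longrightarrow> As ! r \<in> bases M"
  unfolding basis_seqs_def using nth_mem by blast

lemma basis_seqs_length: "As \<in> basis_seqs M m \<Longrightarrow> length As = m"
  by (simp add: basis_seqs_def)

lemma basis_seqs_update:
  "As \<in> basis_seqs M m \<Longrightarrow> X \<in> bases M \<Longrightarrow> As[r := X] \<in> basis_seqs M m"
  unfolding basis_seqs_def using set_update_subset_insert[of As r X] by auto

text \<open>A reordering keeps the multiset of bases. In an exchange, disjointness prevents an
  incoming element from merging with one already present, so no multiplicity drops.\<close>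

lemma te_step_imp_compatible:
  assumes M: "matroid M" and As: "As \<in> basis_seqs M m" and step: "te_step i M As Bs"
  shows "compatible M As Bs"
proof -
  have sub: "compatible M As Bs" if ex: "symmetric_subset_exchange M As Bs"
  proof -
    obtain r s U V where rs: "r < s" "s < length As" and UV: "U \<subseteq> As ! r" "V \<subseteq> As ! s"
      and b: "(As ! r - U) \<union> V \<in> bases M" "(As ! s - V) \<union> U \<in> bases M"
      and Bs: "Bs = As[r := (As ! r - U) \<union> V, s := (As ! s - V) \<union> U]"
      using ex unfolding symmetric_subset_exchange_def by blast
    have "As ! r \<in> bases M" "As ! s \<in> bases M"
      using basis_seqsD[OF As] basis_seqs_length[OF As] rs by auto
    note disj = subset_exchange_disjoint[OF M this UV b]
    have "occ As e = occ Bs e" for e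
    proof -
      have "of_bool (e \<in> (As ! r - U) \<union> V) + of_bool (e \<in> (As ! s - V) \<union> U)
          = (of_bool (e \<in> As ! r) + of_bool (e \<in> As ! s) :: nat)"
        using disj UV by auto
      moreover have "occ (As[r := (As ! r - U) \<union> V]) e + of_bool (e \<in> As ! r)
          = occ As e + of_bool (e \<in> (As ! r - U) \<union> V)"
        by (rule occ_list_update) (use rs in simp)
      moreover have "occ Bs e + of_bool (e \<in> As ! s)
          = occ (As[r := (As ! r - U) \<union> V]) e + of_bool (e \<in> (As ! s - V) \<union> U)"
        unfolding Bs
        using occ_list_update[of s "As[r := (As ! r - U) \<union> V]" "(As ! s - V) \<union> U" e] rs by simp
      ultimately show ?thesis by linarith
    qed
    then show ?thesis by (simp add: compatible_iff_occ Bs)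
  qed
  have reord: "compatible M As Bs" if ro: "reordering As Bs"
  proof -
    have "mset As = mset Bs"
      using ro by (auto simp: reordering_def)
    then have "occ As e = occ Bs e" "length As = length Bs" for e
      unfolding occ_def by (metis mset_map sum_mset_sum_list, metis mset_eq_length)
    then show ?thesis by (simp add: compatible_iff_occ)
  qed
  show ?thesis
    using step sub[OF symmetric_exchange_imp_subset_exchange] sub reord by (auto simp: te_step_def)
qed

text \<open>Spelled exactly as the relation inside \<open>TE\<close>, so that unfolding
  \<open>TE_def\<close> produces it without rewriting.\<close>

abbreviation te_edge :: "nat \<Rightarrow> 'a pre_matroid \<Rightarrow> nat \<Rightarrow> 'a set list \<Rightarrow> 'a set list \<Rightarrow> bool" where
  "te_edge i M m \<equiv> \<lambda>X Y. X \<in> basis_seqs M m \<and> Y \<in> basis_seqs M m \<and> te_step i M X Y"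

lemma te_chain_imp_compatible:
  assumes "matroid M" "(te_edge i M m)\<^sup>*\<^sup>* As Bs"
  shows "compatible M As Bs"
  using assms(2)
proof induction
  case base
  then show ?case by (simp add: compatible_def)
next
  case (step Y Z)
  then show ?case using te_step_imp_compatible[OF assms(1)] compatible_trans by blast
qed

section \<open>The expansion and its bases\<close>

abbreviation proj :: "('a \<times> nat) set list \<Rightarrow> 'a set list" where
  "proj \<equiv> map ((`) fst)"

locale expanded_matroid =
  fixes M :: "'a pre_matroid" and k :: "'a \<Rightarrow> nat"
  assumes matroid_M: "matroid M"
    and copies_pos: "a \<in> ground M \<Longrightarrow> 1 \<le> k a"
begin

abbreviation N :: "('a \<times> nat) pre_matroid" where
  "N \<equiv> expansion k M"

lemma mem_ground_expansion: "p \<in> ground N \<longleftrightarrow> fst p \<in> ground M \<and> snd p \<in> {1..k (fst p)}"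
  by (cases p) (auto simp: expansion_def expand_ground_def)

text \<open>Choosing one copy of each element of a basis amounts to taking a set of copies on which
  \<open>fst\<close> is injective and whose image is that basis. This form avoids handling choice
  functions in all later exchange arguments.\<close>

lemma mem_bases_expansion:
  "S \<in> bases N \<longleftrightarrow> S \<subseteq> ground N \<and> inj_on fst S \<and> fst ` S \<in> bases M"
proof
  assume "S \<in> bases N"
  then obtain A c where A: "A \<in> bases M" and c: "\<forall>a\<in>A. c a \<in> {1..k a}"
    and S: "S = (\<lambda>a. (a, c a)) ` A"
    by (auto simp: expansion_def expand_family_def expand_set_def)
  have "A \<subseteq> ground M" using basis_subset_ground[OF matroid_M A] .
  then have "S \<subseteq> ground N"
    using c unfolding S by (auto simp: mem_ground_expansion)
  moreover have "inj_on fst S" unfolding S by (auto simp: inj_on_def)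
  moreover have "fst ` S = A" unfolding S by force
  ultimately show "S \<subseteq> ground N \<and> inj_on fst S \<and> fst ` S \<in> bases M"
    using A by simp
next
  assume S: "S \<subseteq> ground N \<and> inj_on fst S \<and> fst ` S \<in> bases M"
  \<comment> \<open>The choice function is recovered as the index of the unique point of
    \<open>S\<close> above \<open>a\<close>; its values off the image of \<open>S\<close> do not
    matter.\<close>
  define c where "c a = snd (the_inv_into S fst a)" for a
  have c: "(a, j) \<in> S \<Longrightarrow> c a = j" for a j
    using S the_inv_into_f_f[of fst S "(a, j)"] by (simp add: c_def)
  have "S = (\<lambda>a. (a, c a)) ` fst ` S"
    using c by force
  moreover have "\<forall>a\<in>fst ` S. c a \<in> {1..k a}"
    using S c by (fastforce simp: mem_ground_expansion)
  ultimately show "S \<in> bases N"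
    using S unfolding expansion_def expand_family_def expand_set_def by auto
qed

lemma basis_expansion_unique_copy:
  "S \<in> bases N \<Longrightarrow> (a, j) \<in> S \<Longrightarrow> (a, j') \<in> S \<Longrightarrow> j = j'"
  using inj_onD[of fst S "(a, j)" "(a, j')"] by (simp add: mem_bases_expansion)

text \<open>Index 1 is always available because exponents are positive on the ground set. This makes
  the expansion have a basis and provides a canonical lift of sequences.\<close>

lemma first_copies_basis:
  assumes "A \<in> bases M"
  shows "(\<lambda>a. (a, 1)) ` A \<in> bases N"
  using assms basis_subset_ground[OF matroid_M assms] copies_pos
  unfolding mem_bases_expansion
  by (auto simp: mem_ground_expansion inj_on_def image_image)

text \<open>Two copies of one element are interchangeable in a basis. If \<open>q\<close> already
  lies in \<open>S\<close>, injectivity of \<open>fst\<close> forces \<open>q = p\<close> and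
  nothing changes.\<close>

lemma swap_copy:
  assumes S: "S \<in> bases N" and p: "p \<in> S" and q: "q \<in> ground N" "fst q = fst p"
  shows "insert q (S - {p}) \<in> bases N" "fst ` insert q (S - {p}) = fst ` S"
proof -
  show img: "fst ` insert q (S - {p}) = fst ` S"
    using p q(2) by force
  have "inj_on fst (insert q (S - {p}))"
    using S p q(2) unfolding mem_bases_expansion inj_on_def by auto
  then show "insert q (S - {p}) \<in> bases N"
    using S q(1) img unfolding mem_bases_expansion by auto
qed

text \<open>For the exchange of \<open>x\<close>: if \<open>B\<close> contains another copy of the
  same element, that copy replaces \<open>x\<close>. Otherwise the exchange property of
  \<open>M\<close> is applied to the projections, and the element it returns is lifted to its copy
  in \<open>B\<close>.\<close>

lemma matroid_expansion: "matroid N"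
proof -
  have "ground N = (SIGMA a:ground M. {1..k a})"
    by (simp add: expansion_def expand_ground_def)
  then have "finite (ground N)"
    using matroid_M by (auto simp: matroid_def)
  moreover have "bases N \<noteq> {}"
    using first_copies_basis matroid_M unfolding matroid_def by blast
  moreover have "\<forall>A\<in>bases N. A \<subseteq> ground N"
    by (simp add: mem_bases_expansion)
  moreover have "\<exists>y\<in>B - A. insert y (A - {x}) \<in> bases N"
    if A: "A \<in> bases N" and B: "B \<in> bases N" and x: "x \<in> A - B" for A B x
  proof (cases "fst x \<in> fst ` B")
    case True
    then obtain y where y: "y \<in> B" "fst y = fst x" by force
    \<comment> \<open>Otherwise \<open>x\<close> and \<open>y\<close> would be two points of
      \<open>A\<close> over one element, hence equal, although only \<open>y\<close> lies in
      \<open>B\<close>.\<close>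
    have "y \<notin> A"
      using A x y unfolding mem_bases_expansion by (metis DiffE inj_onD)
    moreover have "insert y (A - {x}) \<in> bases N"
      using swap_copy(1)[OF A _ _ y(2)] x y B by (auto simp: mem_bases_expansion)
    ultimately show ?thesis using y by blast
  next
    case False
    then have "fst x \<in> fst ` A - fst ` B" using x by blast
    then obtain b where b: "b \<in> fst ` B - fst ` A"
      and bas: "insert b (fst ` A - {fst x}) \<in> bases M"
      using basis_exchange[OF matroid_M] A B unfolding mem_bases_expansion by metis
    then obtain y where y: "y \<in> B" "fst y = b" by blast
    have inj: "inj_on fst A" using A by (simp add: mem_bases_expansion)
    have img: "fst ` (A - {x}) = fst ` A - {fst x}"
      using inj_on_image_set_diff[OF inj, of A "{x}"] x by simp
    have "inj_on fst (insert y (A - {x}))"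
      using inj b y by (auto simp: inj_on_insert intro: inj_on_subset)
    moreover have "insert y (A - {x}) \<subseteq> ground N"
      using A B y(1) unfolding mem_bases_expansion by blast
    moreover have "fst ` insert y (A - {x}) \<in> bases M"
      using bas by (simp add: img y(2))
    ultimately have "insert y (A - {x}) \<in> bases N"
      by (simp add: mem_bases_expansion)
    moreover have "y \<notin> A" using b unfolding y(2)[symmetric] by blast
    ultimately show ?thesis using y(1) by blast
  qed
  ultimately show ?thesis unfolding matroid_def by blast
qed

section \<open>Projection of sequences and steps\<close>

lemma proj_basis_seqs: "As \<in> basis_seqs N m \<Longrightarrow> proj As \<in> basis_seqs M m"
  by (auto simp: basis_seqs_def mem_bases_expansion)

text \<open>A basis of the expansion contains at most one copy of \<open>a\<close>, so the indicator
  of \<open>a\<close> in its projection is the sum of the indicators of the copies.\<close>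

lemma occ_proj:
  assumes "set As \<subseteq> bases N" "a \<in> ground M"
  shows "occ (proj As) a = (\<Sum>j\<in>{1..k a}. occ As (a, j))"
  using assms(1)
proof (induction As)
  case Nil
  then show ?case by (simp add: occ_def)
next
  case (Cons S As)
  then have S: "S \<in> bases N" by simp
  have "of_bool (a \<in> fst ` S) = (\<Sum>j\<in>{1..k a}. of_bool ((a, j) \<in> S) :: nat)"
  proof (cases "a \<in> fst ` S")
    case True
    then obtain j where j: "(a, j) \<in> S" by force
    then have "j \<in> {1..k a}"
      using S by (force simp: mem_bases_expansion mem_ground_expansion)
    moreover have "(a, j') \<in> S \<longleftrightarrow> j' = j" for j'
      using basis_expansion_unique_copy[OF S] j by blast
    ultimately show ?thesis using True by (simp add: of_bool_def)
  next
    case False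
    then have "(a, j) \<notin> S" for j by force
    then show ?thesis using False by simp
  qed
  then show ?case
    using Cons by (simp add: occ_def sum.distrib)
qed

lemma compatible_proj:
  assumes "As \<in> basis_seqs N m" "Bs \<in> basis_seqs N m" "compatible N As Bs"
  shows "compatible M (proj As) (proj Bs)"
proof -
  have "occ (proj As) a = occ (proj Bs) a" if a: "a \<in> ground M" for a
    using assms a
    by (auto simp: occ_proj basis_seqs_def compatible_iff_occ mem_ground_expansion intro!: sum.cong)
  then show ?thesis using assms(3) by (simp add: compatible_iff_occ)
qed

text \<open>Injectivity of \<open>fst\<close> on a basis lets images commute with removal of points.
  Exchanging two copies of one element projects to exchanging that element with itself, which still
  counts as a symmetric exchange, so no case split arises.\<close>

lemma symmetric_exchange_proj:
  assumes As: "As \<in> basis_seqs N m" and ex: "symmetric_exchange N As Bs"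
  shows "symmetric_exchange M (proj As) (proj Bs)"
proof -
  obtain r s x y where rs: "r < s" "s < length As" and xy: "x \<in> As ! r" "y \<in> As ! s"
    and b: "(As ! r - {x}) \<union> {y} \<in> bases N" "(As ! s - {y}) \<union> {x} \<in> bases N"
    and Bs: "Bs = As[r := (As ! r - {x}) \<union> {y}, s := (As ! s - {y}) \<union> {x}]"
    using ex unfolding symmetric_exchange_def by blast
  have "inj_on fst (As ! r)" "inj_on fst (As ! s)"
    using basis_seqsD[OF As] basis_seqs_length[OF As] rs by (auto simp: mem_bases_expansion)
  then have img: "fst ` ((As ! r - {x}) \<union> {y}) = (fst ` (As ! r) - {fst x}) \<union> {fst y}"
    "fst ` ((As ! s - {y}) \<union> {x}) = (fst ` (As ! s) - {fst y}) \<union> {fst x}"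
    using xy inj_on_image_set_diff[of fst "As ! r" "As ! r" "{x}"]
      inj_on_image_set_diff[of fst "As ! s" "As ! s" "{y}"] by auto
  show ?thesis
    unfolding symmetric_exchange_def
  proof (intro exI conjI)
    show "(proj As ! r - {fst x}) \<union> {fst y} \<in> bases M"
      "(proj As ! s - {fst y}) \<union> {fst x} \<in> bases M"
      using b img rs by (simp_all add: mem_bases_expansion)
    show "proj Bs = (proj As)[r := (proj As ! r - {fst x}) \<union> {fst y},
        s := (proj As ! s - {fst y}) \<union> {fst x}]"
      unfolding Bs map_update img using rs by simp
  qed (use rs xy in auto)
qed

lemma symmetric_subset_exchange_proj:
  assumes As: "As \<in> basis_seqs N m" and ex: "symmetric_subset_exchange N As Bs"
  shows "symmetric_subset_exchange M (proj As) (proj Bs)"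
proof -
  obtain r s U V where rs: "r < s" "s < length As" and UV: "U \<subseteq> As ! r" "V \<subseteq> As ! s"
    and b: "(As ! r - U) \<union> V \<in> bases N" "(As ! s - V) \<union> U \<in> bases N"
    and Bs: "Bs = As[r := (As ! r - U) \<union> V, s := (As ! s - V) \<union> U]"
    using ex unfolding symmetric_subset_exchange_def by blast
  have "inj_on fst (As ! r)" "inj_on fst (As ! s)"
    using basis_seqsD[OF As] basis_seqs_length[OF As] rs by (auto simp: mem_bases_expansion)
  then have img: "fst ` ((As ! r - U) \<union> V) = (fst ` (As ! r) - fst ` U) \<union> fst ` V"
    "fst ` ((As ! s - V) \<union> U) = (fst ` (As ! s) - fst ` V) \<union> fst ` U"
    using inj_on_image_set_diff[OF _ Diff_subset UV(1), of fst]
      inj_on_image_set_diff[OF _ Diff_subset UV(2), of fst]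
    by (simp_all add: image_Un)
  show ?thesis
    unfolding symmetric_subset_exchange_def
  proof (intro exI conjI)
    show "(proj As ! r - fst ` U) \<union> fst ` V \<in> bases M"
      "(proj As ! s - fst ` V) \<union> fst ` U \<in> bases M"
      using b img rs by (simp_all add: mem_bases_expansion)
    show "proj Bs = (proj As)[r := (proj As ! r - fst ` U) \<union> fst ` V,
        s := (proj As ! s - fst ` V) \<union> fst ` U]"
      unfolding Bs map_update img using rs by simp
  qed (use rs UV in auto)
qed

lemma te_step_proj:
  assumes As: "As \<in> basis_seqs N m" and step: "te_step i N As Bs"
  shows "te_step i M (proj As) (proj Bs)"
proof -
  have "reordering (proj As) (proj Bs)" if "reordering As Bs"
    using that unfolding reordering_def by (auto simp: permute_list_map)
  then show ?thesis
    using step symmetric_exchange_proj[OF As] symmetric_subset_exchange_proj[OF As]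
    unfolding te_step_def by blast
qed

lemma te_chain_proj:
  assumes "(te_edge i N m)\<^sup>*\<^sup>* As Bs"
  shows "(te_edge i M m)\<^sup>*\<^sup>* (proj As) (proj Bs)"
  using assms
proof induction
  case (step Y Z)
  then have "te_edge i M m (proj Y) (proj Z)"
    using te_step_proj proj_basis_seqs by blast
  then show ?case using step.IH by (rule rtranclp.rtrancl_into_rtrancl[rotated])
qed simp

section \<open>Lifting of steps\<close>

text \<open>The points over \<open>U\<close> leave \<open>S\<close> and the points of
  \<open>T\<close> over \<open>V\<close> enter. Disjointness of the projections of the two remaining
  pieces is what keeps two copies of one element from meeting in \<open>R\<close>.\<close>

lemma lift_subset_exchange_basis:
  assumes S: "S \<in> bases N" and T: "T \<in> bases N"
    and b: "(fst ` S - U) \<union> V \<in> bases M" and V: "V \<subseteq> fst ` T"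
    and disj: "(fst ` S - U) \<inter> V = {}"
  defines "R \<equiv> (S - {p \<in> S. fst p \<in> U}) \<union> {p \<in> T. fst p \<in> V}"
  shows "R \<in> bases N" "fst ` R = (fst ` S - U) \<union> V"
proof -
  have img1: "fst ` (S - {p \<in> S. fst p \<in> U}) = fst ` S - U" by auto
  have img2: "fst ` {p \<in> T. fst p \<in> V} = V" using V by auto
  show img: "fst ` R = (fst ` S - U) \<union> V"
    unfolding R_def image_Un img1 img2 ..
  have inj: "inj_on fst S" "inj_on fst T"
    using S T by (simp_all add: mem_bases_expansion)
  have "inj_on fst R"
    unfolding R_def inj_on_Un
  proof (intro conjI)
    show "inj_on fst (S - {p \<in> S. fst p \<in> U})"
      by (rule inj_on_subset[OF inj(1)]) blast
    show "inj_on fst {p \<in> T. fst p \<in> V}"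
      by (rule inj_on_subset[OF inj(2)]) blast
    show "fst ` (S - {p \<in> S. fst p \<in> U} - {p \<in> T. fst p \<in> V})
        \<inter> fst ` ({p \<in> T. fst p \<in> V} - (S - {p \<in> S. fst p \<in> U})) = {}"
      using disj unfolding img1[symmetric] by auto
  qed
  moreover have "R \<subseteq> ground N"
    using S T unfolding R_def mem_bases_expansion by blast
  ultimately show "R \<in> bases N"
    using b img by (simp add: mem_bases_expansion)
qed

lemma symmetric_subset_exchange_lift:
  assumes As: "As \<in> basis_seqs N m" and ex: "symmetric_subset_exchange M (proj As) Bs"
  obtains Bs' where "symmetric_subset_exchange N As Bs'" "proj Bs' = Bs" "Bs' \<in> basis_seqs N m"
proof -
  obtain r s U V where rs: "r < s" "s < length As"
    and UV: "U \<subseteq> fst ` (As ! r)" "V \<subseteq> fst ` (As ! s)"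
    and b: "(fst ` (As ! r) - U) \<union> V \<in> bases M" "(fst ` (As ! s) - V) \<union> U \<in> bases M"
    and Bs: "Bs = (proj As)[r := (fst ` (As ! r) - U) \<union> V, s := (fst ` (As ! s) - V) \<union> U]"
    using ex unfolding symmetric_subset_exchange_def by auto
  have bN: "As ! r \<in> bases N" "As ! s \<in> bases N"
    using basis_seqsD[OF As] basis_seqs_length[OF As] rs by auto
  then have "fst ` (As ! r) \<in> bases M" "fst ` (As ! s) \<in> bases M"
    by (auto simp: mem_bases_expansion)
  note disj = subset_exchange_disjoint[OF matroid_M this UV b]
  define U' where "U' = {p \<in> As ! r. fst p \<in> U}"
  define V' where "V' = {p \<in> As ! s. fst p \<in> V}"
  note R = lift_subset_exchange_basis[OF bN b(1) UV(2) disj(1), folded U'_def V'_def]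
    lift_subset_exchange_basis[OF bN(2,1) b(2) UV(1) disj(2), folded U'_def V'_def]
  let ?Bs = "As[r := (As ! r - U') \<union> V', s := (As ! s - V') \<union> U']"
  show ?thesis
  proof
    show "symmetric_subset_exchange N As ?Bs"
      unfolding symmetric_subset_exchange_def using R rs
      by (intro exI[of _ r] exI[of _ s] exI[of _ U'] exI[of _ V']) (auto simp: U'_def V'_def)
    show "proj ?Bs = Bs"
      unfolding Bs map_update R ..
    show "?Bs \<in> basis_seqs N m"
      using As R by (intro basis_seqs_update)
  qed
qed

text \<open>Treated apart from subset exchanges because the lifted step must again move single
  elements, as the first two kinds of step demand.\<close>

lemma symmetric_exchange_lift:
  assumes As: "As \<in> basis_seqs N m" and ex: "symmetric_exchange M (proj As) Bs"
  obtains Bs' where "symmetric_exchange N As Bs'" "proj Bs' = Bs" "Bs' \<in> basis_seqs N m"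
proof -
  obtain r s x y where rs: "r < s" "s < length As"
    and xy: "x \<in> fst ` (As ! r)" "y \<in> fst ` (As ! s)"
    and b: "(fst ` (As ! r) - {x}) \<union> {y} \<in> bases M" "(fst ` (As ! s) - {y}) \<union> {x} \<in> bases M"
    and Bs: "Bs = (proj As)[r := (fst ` (As ! r) - {x}) \<union> {y}, s := (fst ` (As ! s) - {y}) \<union> {x}]"
    using ex unfolding symmetric_exchange_def by auto
  have bN: "As ! r \<in> bases N" "As ! s \<in> bases N"
    using basis_seqsD[OF As] basis_seqs_length[OF As] rs by auto
  then have bM: "fst ` (As ! r) \<in> bases M" "fst ` (As ! s) \<in> bases M"
    by (auto simp: mem_bases_expansion)
  have sub: "{x} \<subseteq> fst ` (As ! r)" "{y} \<subseteq> fst ` (As ! s)"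
    using xy by auto
  note disj = subset_exchange_disjoint[OF matroid_M bM sub b]
  obtain p q where p: "p \<in> As ! r" "fst p = x" and q: "q \<in> As ! s" "fst q = y"
    using xy by blast
  \<comment> \<open>A basis has exactly one point over each element of its projection, so the sets
    moved by the general lift are singletons.\<close>
  have copies: "{z \<in> As ! r. fst z \<in> {x}} = {p}" "{z \<in> As ! s. fst z \<in> {y}} = {q}"
    using bN p q unfolding mem_bases_expansion by (auto dest: inj_onD)
  note R = lift_subset_exchange_basis[OF bN b(1) sub(2) disj(1), unfolded copies]
    lift_subset_exchange_basis[OF bN(2,1) b(2) sub(1) disj(2), unfolded copies]
  let ?Bs = "As[r := (As ! r - {p}) \<union> {q}, s := (As ! s - {q}) \<union> {p}]"
  show ?thesis
  proof
    show "symmetric_exchange N As ?Bs"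
      unfolding symmetric_exchange_def using R rs p q
      by (intro exI[of _ r] exI[of _ s] exI[of _ p] exI[of _ q]) auto
    show "proj ?Bs = Bs"
      unfolding Bs map_update R ..
    show "?Bs \<in> basis_seqs N m"
      using As R by (intro basis_seqs_update)
  qed
qed

lemma te_step_lift:
  assumes As: "As \<in> basis_seqs N m" and step: "te_step i M (proj As) Bs"
  obtains Bs' where "te_step i N As Bs'" "proj Bs' = Bs" "Bs' \<in> basis_seqs N m"
proof -
  consider (ex) "i \<in> {1, 2}" "symmetric_exchange M (proj As) Bs"
    | (perm) "i = 2" "reordering (proj As) Bs"
    | (sub) "i = 3" "symmetric_subset_exchange M (proj As) Bs"
    using step unfolding te_step_def by blast
  then show ?thesis
  proof cases
    case ex
    then show ?thesis
      using symmetric_exchange_lift[OF As ex(2)] that unfolding te_step_def by blast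
  next
    case perm
    then obtain p where p: "p permutes {..<length As}" "Bs = permute_list p (proj As)"
      by (auto simp: reordering_def)
    show ?thesis
    proof
      show "te_step i N As (permute_list p As)"
        using perm(1) p by (auto simp: te_step_def reordering_def)
      show "proj (permute_list p As) = Bs"
        using p by (simp add: permute_list_map)
      show "permute_list p As \<in> basis_seqs N m"
        using As p(1) by (simp add: basis_seqs_def)
    qed
  next
    case sub
    then show ?thesis
      using symmetric_subset_exchange_lift[OF As sub(2)] that unfolding te_step_def by blast
  qed
qed

text \<open>Lifting proceeds step by step from the prescribed start, so only the projection of the
  endpoint is controlled, not which copies occur in it.\<close>

lemma te_chain_lift:
  assumes "(te_edge i M m)\<^sup>*\<^sup>* (proj As) Bs" "As \<in> basis_seqs N m"
  shows "\<exists>Bs'. (te_edge i N m)\<^sup>*\<^sup>* As Bs' \<and> proj Bs' = Bs \<and> Bs' \<in> basis_seqs N m"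
  using assms(1)
proof induction
  case base
  then show ?case using assms(2) by blast
next
  case (step Y Z)
  then obtain Y' where Y': "(te_edge i N m)\<^sup>*\<^sup>* As Y'" "proj Y' = Y" "Y' \<in> basis_seqs N m"
    by blast
  then obtain Z' where Z': "te_step i N Y' Z'" "proj Z' = Z" "Z' \<in> basis_seqs N m"
    using te_step_lift[OF Y'(3), of i Z] step.hyps(2) by blast
  have "(te_edge i N m)\<^sup>*\<^sup>* As Z'"
    using Y'(1) by (rule rtranclp.rtrancl_into_rtrancl) (use Y'(3) Z' in simp)
  then show ?case using Z' by blast
qed

section \<open>Redistribution of copies over a fixed projection\<close>

text \<open>Induction on the total number of copies in \<open>As\<close> that are misplaced relative
  to \<open>Bs\<close>. Each round swaps two copies of one element between two positions; this is a
  symmetric exchange, hence a step of every kind.\<close>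

lemma te_chain_same_proj:
  assumes "i \<in> {1, 2, 3}" "As \<in> basis_seqs N m" "Bs \<in> basis_seqs N m"
    and "proj As = proj Bs" "compatible N As Bs"
  shows "(te_edge i N m)\<^sup>*\<^sup>* As Bs"
  using assms(2,4,5)
proof (induction "\<Sum>r<m. card (As ! r - Bs ! r)" arbitrary: As rule: less_induct)
  case less
  note As = less.prems(1) and Bs = assms(3)
  have len: "length As = m" "length Bs = m"
    using As Bs by (simp_all add: basis_seqs_length)
  have same: "fst ` (As ! r) = fst ` (Bs ! r)" if "r < m" for r
    using arg_cong[OF less.prems(2), of "\<lambda>Xs. Xs ! r"] that len by simp
  show ?case
  proof (cases "As = Bs")
    case False
    then obtain r where r: "r < m" "As ! r \<noteq> Bs ! r"
      using len by (metis nth_equalityI)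
    have bas: "\<And>t. t < m \<Longrightarrow> As ! t \<in> bases N" "\<And>t. t < m \<Longrightarrow> Bs ! t \<in> bases N"
      using basis_seqsD[OF As] basis_seqsD[OF Bs] by auto
    have "\<not> As ! r \<subseteq> Bs ! r"
    proof
      assume "As ! r \<subseteq> Bs ! r"
      then have "As ! r = Bs ! r"
        using same[OF r(1)] bas(2)[OF r(1)] inj_on_image_eq_iff[of fst "Bs ! r" "As ! r" "Bs ! r"]
        by (simp add: mem_bases_expansion)
      then show False using r(2) by blast
    qed
    then obtain p where p: "p \<in> As ! r" "p \<notin> Bs ! r" by blast
    then obtain q where q: "q \<in> Bs ! r" "fst q = fst p"
      using same[OF r(1)] by (metis imageE imageI)
    have pq: "p \<noteq> q" using p q by blast
    have q_notin: "q \<notin> As ! r"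
      using bas(1)[OF r(1)] p q pq unfolding mem_bases_expansion by (metis inj_onD)
    have ground: "p \<in> ground N" "q \<in> ground N"
      using bas r(1) p q unfolding mem_bases_expansion by blast+
    \<comment> \<open>Counting: if each basis of \<open>As\<close> containing \<open>q\<close> had a
      counterpart in \<open>Bs\<close> containing it, position \<open>r\<close> would give
      \<open>Bs\<close> an extra occurrence of \<open>q\<close>, against compatibility.\<close>
    have "\<exists>s<m. q \<in> As ! s \<and> q \<notin> Bs ! s"
    proof (rule ccontr)
      assume "\<not> ?thesis"
      then have "{t. t < m \<and> q \<in> As ! t} \<subset> {t. t < m \<and> q \<in> Bs ! t}"
        using r(1) q(1) q_notin by blast
      then have "card {t. t < m \<and> q \<in> As ! t} < card {t. t < m \<and> q \<in> Bs ! t}"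
        by (intro psubset_card_mono) auto
      then show False
        using less.prems(3) ground(2) len by (simp add: compatible_def)
    qed
    then obtain s where s: "s < m" "q \<in> As ! s" "q \<notin> Bs ! s" by blast
    have rs: "r \<noteq> s" using s q_notin by blast
    let ?X = "insert q (As ! r - {p})" and ?Y = "insert p (As ! s - {q})"
    let ?Cs = "As[r := ?X, s := ?Y]"
    note X = swap_copy[OF bas(1)[OF r(1)] p(1) ground(2) q(2)]
    note Y = swap_copy[OF bas(1)[OF s(1)] s(2) ground(1) q(2)[symmetric]]
    have Cs: "?Cs \<in> basis_seqs N m"
      using As X Y by (intro basis_seqs_update)
    have "symmetric_exchange N As ?Cs"
      using rs r s p X Y len by (intro symmetric_exchangeI[of r s]) auto
    then have step: "te_step i N As ?Cs"
      by (rule symmetric_exchange_imp_te_step[OF assms(1)])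
    have "proj ?Cs = proj As"
      unfolding map_update X Y
      by (metis list_update_id map_update)
    then have proj: "proj ?Cs = proj Bs" using less.prems(2) by simp
    have compat: "compatible N ?Cs Bs"
      using te_step_imp_compatible[OF matroid_expansion As step] less.prems(3)
        compatible_sym compatible_trans by blast
    have fin: "finite (As ! t)" if "t < m" for t
      using basis_finite[OF matroid_expansion bas(1)[OF that]] .
    have nth: "?Cs ! t = (if t = s then ?Y else if t = r then ?X else As ! t)" if "t < m" for t
      using len rs that by (auto simp: nth_list_update)
    \<comment> \<open>At \<open>r\<close> the misplaced \<open>p\<close> leaves, and the entering
      \<open>q\<close> belongs to \<open>Bs ! r\<close>.\<close>
    have r_less: "card (?Cs ! r - Bs ! r) < card (As ! r - Bs ! r)"
      unfolding nth[OF r(1)] using rs p q fin[OF r(1)] by (auto intro!: psubset_card_mono)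
    \<comment> \<open>At \<open>s\<close> the misplaced \<open>q\<close> leaves; \<open>p\<close>
      may itself be misplaced there, so only a weak inequality holds.\<close>
    have s_le: "card (?Cs ! s - Bs ! s) \<le> card (As ! s - Bs ! s)"
    proof -
      have "card (?Y - Bs ! s) \<le> card (insert p (As ! s - Bs ! s - {q}))"
        using fin[OF s(1)] by (intro card_mono) auto
      also have "\<dots> \<le> Suc (card (As ! s - Bs ! s - {q}))"
        using fin[OF s(1)] by (simp add: card_insert_if)
      also have "\<dots> = card (As ! s - Bs ! s)"
        using fin[OF s(1)] s by (intro card.remove[symmetric]) auto
      finally show ?thesis using nth[OF s(1)] by simp
    qed
    have "(\<Sum>t<m. card (?Cs ! t - Bs ! t)) < (\<Sum>t<m. card (As ! t - Bs ! t))"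
    proof (rule sum_strict_mono_ex1)
      show "\<forall>t\<in>{..<m}. card (?Cs ! t - Bs ! t) \<le> card (As ! t - Bs ! t)"
      proof
        fix t assume "t \<in> {..<m}"
        then show "card (?Cs ! t - Bs ! t) \<le> card (As ! t - Bs ! t)"
          using r_less s_le nth[of t] by (cases "t = r \<or> t = s") auto
      qed
      show "\<exists>t\<in>{..<m}. card (?Cs ! t - Bs ! t) < card (As ! t - Bs ! t)"
        using r_less r(1) by blast
    qed simp
    then have "(te_edge i N m)\<^sup>*\<^sup>* ?Cs Bs"
      using less.hyps Cs proj compat by blast
    then show ?thesis
      using As Cs step by (intro converse_rtranclp_into_rtranclp[of _ As ?Cs]) auto
  qed simp
qed

section \<open>The two directions of the equivalence\<close>

lemma TE_expansion:
  assumes i: "i \<in> {1, 2, 3}" and TE: "M \<in> TE i"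
  shows "N \<in> TE i"
proof -
  have "(te_edge i N m)\<^sup>*\<^sup>* As Bs"
    if m: "m \<ge> 1" and As: "As \<in> basis_seqs N m" and Bs: "Bs \<in> basis_seqs N m"
      and comp: "compatible N As Bs" for m As Bs
  proof -
    have "(te_edge i M m)\<^sup>*\<^sup>* (proj As) (proj Bs)"
      using TE m proj_basis_seqs[OF As] proj_basis_seqs[OF Bs] compatible_proj[OF As Bs comp]
      unfolding TE_def by blast
    then obtain Cs where Cs: "(te_edge i N m)\<^sup>*\<^sup>* As Cs" "proj Cs = proj Bs" "Cs \<in> basis_seqs N m"
      using te_chain_lift[OF _ As] by blast
    \<comment> \<open>Steps preserve multiplicities, so \<open>Cs\<close> inherits compatibility
      with \<open>Bs\<close> from \<open>As\<close>; its projection already agrees with that of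
      \<open>Bs\<close>.\<close>
    have "compatible N Cs Bs"
      using te_chain_imp_compatible[OF matroid_expansion Cs(1)] comp
        compatible_sym compatible_trans by blast
    then have "(te_edge i N m)\<^sup>*\<^sup>* Cs Bs"
      using te_chain_same_proj[OF i Cs(3) Bs Cs(2)] by blast
    then show ?thesis using Cs(1) by (rule rtranclp_trans[rotated])
  qed
  then show ?thesis unfolding TE_def using matroid_expansion by blast
qed

lemma TE_of_TE_expansion:
  assumes TE: "N \<in> TE i"
  shows "M \<in> TE i"
proof -
  \<comment> \<open>The section of \<open>proj\<close> that always takes the first copy; a chain
    between lifts then projects back to the original sequences.\<close>
  define lift where "lift = map ((`) (\<lambda>a::'a. (a, 1::nat)))"
  have proj_lift: "proj (lift As) = As" for As
    by (simp add: lift_def comp_def image_image)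
  have lift_seqs: "lift As \<in> basis_seqs N m" if "As \<in> basis_seqs M m" for As m
    using that first_copies_basis by (auto simp: basis_seqs_def lift_def)
  have "(te_edge i M m)\<^sup>*\<^sup>* As Bs"
    if m: "m \<ge> 1" and As: "As \<in> basis_seqs M m" and Bs: "Bs \<in> basis_seqs M m"
      and comp: "compatible M As Bs" for m As Bs
  proof -
    have occ_lift: "occ (lift Cs) (a, j) = (if j = 1 then occ Cs a else 0)" for Cs a j
      unfolding lift_def occ_def by (induction Cs) auto
    \<comment> \<open>First copies carry the original multiplicities, and all other copies occur in
      neither lift.\<close>
    have "compatible N (lift As) (lift Bs)"
      using comp unfolding compatible_iff_occ
      by (auto simp: occ_lift mem_ground_expansion) (simp_all add: lift_def)
    then have "(te_edge i N m)\<^sup>*\<^sup>* (lift As) (lift Bs)"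
      using TE m lift_seqs[OF As] lift_seqs[OF Bs] unfolding TE_def by blast
    then have "(te_edge i M m)\<^sup>*\<^sup>* (proj (lift As)) (proj (lift Bs))"
      by (rule te_chain_proj)
    then show ?thesis by (simp only: proj_lift)
  qed
  then show ?thesis unfolding TE_def using matroid_M by blast
qed

end

theorem theorem3p6:
  fixes M :: "'a pre_matroid" and x :: "nat \<Rightarrow> 'a" and n i :: nat and k :: "'a \<Rightarrow> nat"
  assumes "matroid M"
    and "inj_on x {1..n}" and "ground M = x ` {1..n}"
    and "\<And>l. l \<in> {1..n} \<Longrightarrow> 1 \<le> k (x l)"
    and "i \<in> {1, 2, 3}"
  shows "M \<in> TE i \<longleftrightarrow> expansion k M \<in> TE i"
proof -
  \<comment> \<open>Each ground element is some \<open>x l\<close> with \<open>l\<close> in the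
    index range, which transfers the bound on the exponents to the ground set.\<close>
  interpret expanded_matroid M k
    using assms(1,3,4) by unfold_locales auto
  show ?thesis
    using TE_expansion[OF assms(5)] TE_of_TE_expansion by (rule iffI)
qed

end
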